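(* Let $p$ be a prime with $p\equiv 15$ or $27\pmod{28}$. For all integers $n,k\geq 0$ with $p\nmid n$, \[ c_{11,3}\left(8p^{2k+1}n+\frac{122p^{2k+2}+4}{7}\right)\equiv 0\pmod 2. \]
   Context: For complex $a,b$ the false theta function is $\Psi(a,b):=\sum_{n=0}^\infty a^{n(n+1)/2}b^{n(n-1)/2}-\sum_{n=-\infty}^{-1}a^{n(n+1)/2}b^{n(n-1)/2}$. For positive integers $r,s$, the integers $c_{r,s}(n)$ ($n\ge 0$) are defined by the power series identity $\sum_{n=0}^\infty c_{r,s}(n)q^n=\dfrac{1}{\Psi(-q^r,q^s)}$ (the denominator is a power series in $q$ with constant term $1$). *)

theory Defs
  imports
    "HOL-Computational_Algebra.Formal_Power_Series"
    "HOL-Number_Theory.Number_Theory"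
begin

text \<open>
  Both exponents \<open>n (n + 1) / 2\<close> and \<open>n (n - 1) / 2\<close> are nonnegative integers for every
  integer \<open>n\<close>, so neither \<open>div\<close> nor \<open>nat\<close> loses anything here.
\<close>

definition theta_term :: "'a::comm_ring_1 \<Rightarrow> 'a \<Rightarrow> int \<Rightarrow> 'a" where
  "theta_term a b n = a ^ nat (n * (n + 1) div 2) * b ^ nat (n * (n - 1) div 2)"

text \<open>
  The false theta function. The definition makes sense over any topological commutative ring.
  For complex \<open>a, b\<close> with \<open>norm (a * b) < 1\<close> it is the usual analytic function; for formal power series, whose topology
  is the \<open>X\<close>-adic one, it gives the series obtained by substituting powers of \<open>q = X\<close>
  for \<open>a\<close> and \<open>b\<close>. The index \<open>n \<le> -1\<close> of the second sum is written as \<open>- int (Suc m)\<close>.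
\<close>

definition false_theta :: "'a::{topological_space, comm_ring_1} \<Rightarrow> 'a \<Rightarrow> 'a" where
  "false_theta a b =
     (\<Sum>n. theta_term a b (int n)) - (\<Sum>m. theta_term a b (- int (Suc m)))"

definition theta_series :: "nat \<Rightarrow> nat \<Rightarrow> int fps" where
  "theta_series r s = false_theta (- (fps_X ^ r)) (fps_X ^ s)"

text \<open>
  The inverse is taken in the ring of power series over the integers (on which \<open>inverse\<close>
  is not available); the second argument of \<^term>\<open>fps_right_inverse\<close> is the constant term of the
  result. That this is indeed the inverse for positive \<open>r\<close> and \<open>s\<close> is shown below.
\<close>

definition theta_recip_coeff :: "nat \<Rightarrow> nat \<Rightarrow> nat \<Rightarrow> int" where
  "theta_recip_coeff r s n = fps_nth (fps_right_inverse (theta_series r s) 1) n"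

lemma fps_sums_triangular:
  fixes f :: "nat \<Rightarrow> 'a::comm_ring_1 fps"
  assumes "\<And>i m. m < i \<Longrightarrow> fps_nth (f i) m = 0"
  shows "f sums Abs_fps (\<lambda>m. \<Sum>i\<le>m. fps_nth (f i) m)"
  unfolding sums_def
proof (rule tendsto_fpsI)
  fix m
  have "fps_nth (sum f {..<N}) m = (\<Sum>i\<le>m. fps_nth (f i) m)" if "N \<ge> Suc m" for N
    unfolding fps_sum_nth
    by (rule sum.mono_neutral_right) (use that assms in auto)
  then show "\<forall>\<^sub>F N in sequentially.
      fps_nth (sum f {..<N}) m = fps_nth (Abs_fps (\<lambda>m. \<Sum>i\<le>m. fps_nth (f i) m)) m"
    by (auto simp: eventually_sequentially)
qed

lemma theta_term_fps:
  "theta_term (- (fps_X ^ r)) (fps_X ^ s) n =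
     fps_const ((-1) ^ nat (n * (n + 1) div 2)) *
     (fps_X ^ (r * nat (n * (n + 1) div 2) + s * nat (n * (n - 1) div 2)) :: int fps)"
proof -
  have "(-1 :: int fps) ^ k = fps_const ((-1) ^ k)" for k
    by (induction k) (simp_all flip: fps_const_neg fps_const_mult)
  then show ?thesis
    unfolding theta_term_def
    by (subst power_minus) (simp add: power_add power_mult mult.assoc)
qed

lemma theta_exponent_nonneg_index: "nat (int i * (int i + 1) div 2) \<ge> i"
proof -
  have "int i * 2 \<le> int i * (int i + 1)"
    by (cases "i = 0") (auto intro!: mult_left_mono)
  then have "int i \<le> int i * (int i + 1) div 2"
    by linarith
  then show ?thesis by linarith
qed

lemma theta_exponent_neg_index:
  "nat (- int (Suc i) * (- int (Suc i) - 1) div 2) \<ge> Suc i"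
proof -
  have "- int (Suc i) * (- int (Suc i) - 1) = int (Suc i) * (int (Suc i) + 1)"
    by (simp add: algebra_simps)
  then show ?thesis
    using theta_exponent_nonneg_index[of "Suc i"] by simp
qed

lemma theta_term_nth_eq_0:
  assumes "r > 0" "s > 0"
  shows "m < i \<Longrightarrow>
           fps_nth (theta_term (- (fps_X ^ r)) (fps_X ^ s) (int i) :: int fps) m = 0"
    and "m \<le> i \<Longrightarrow>
           fps_nth (theta_term (- (fps_X ^ r)) (fps_X ^ s) (- int (Suc i)) :: int fps) m = 0"
proof -
  assume "m < i"
  moreover have "r * nat (int i * (int i + 1) div 2) \<ge> i"
    using theta_exponent_nonneg_index[of i] assms(1)
    by (metis One_nat_def Suc_leI le_trans mult_le_mono1 nat_mult_1)
  ultimately show "fps_nth (theta_term (- (fps_X ^ r)) (fps_X ^ s) (int i) :: int fps) m = 0"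
    by (simp add: theta_term_fps fps_X_power_nth)
next
  assume "m \<le> i"
  moreover have "s * nat (- int (Suc i) * (- int (Suc i) - 1) div 2) \<ge> Suc i"
    using theta_exponent_neg_index[of i] assms(2)
    by (metis One_nat_def Suc_leI le_trans mult_le_mono1 nat_mult_1)
  ultimately show
    "fps_nth (theta_term (- (fps_X ^ r)) (fps_X ^ s) (- int (Suc i)) :: int fps) m = 0"
    by (simp only: theta_term_fps fps_mult_left_const_nth fps_X_power_nth) auto
qed

lemma theta_series_sums:
  assumes "r > 0" "s > 0"
  defines "T \<equiv> (theta_term (- (fps_X ^ r)) (fps_X ^ s) :: int \<Rightarrow> int fps)"
  shows "(\<lambda>n. T (int n)) sums Abs_fps (\<lambda>m. \<Sum>i\<le>m. fps_nth (T (int i)) m)"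
    and "(\<lambda>n. T (- int (Suc n))) sums Abs_fps (\<lambda>m. \<Sum>i\<le>m. fps_nth (T (- int (Suc i))) m)"
  using theta_term_nth_eq_0[OF assms(1,2)] unfolding T_def
  by (intro fps_sums_triangular; simp only: less_imp_le)+

lemma theta_series_nth:
  assumes "r > 0" "s > 0"
  defines "T \<equiv> (theta_term (- (fps_X ^ r)) (fps_X ^ s) :: int \<Rightarrow> int fps)"
  shows "fps_nth (theta_series r s) m =
           (\<Sum>i\<le>m. fps_nth (T (int i)) m) - (\<Sum>i\<le>m. fps_nth (T (- int (Suc i))) m)"
  unfolding theta_series_def false_theta_def T_def
  using theta_series_sums[OF assms(1,2), THEN sums_unique, symmetric] by simp

lemma theta_series_nth_0:
  assumes "r > 0" "s > 0"
  shows "fps_nth (theta_series r s) 0 = 1"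
  using theta_term_nth_eq_0(2)[OF assms, of 0 0]
  by (simp add: theta_series_nth[OF assms]) (simp add: theta_term_def)

lemma theta_series_mult_recip:
  assumes "r > 0" "s > 0"
  shows "theta_series r s * Abs_fps (theta_recip_coeff r s) = 1"
  unfolding theta_recip_coeff_def fps_nth_inverse
  by (rule fps_right_inverse) (simp add: theta_series_nth_0[OF assms])

lemma seven_dvd_progression_offset:
  fixes p k :: nat
  assumes "p mod 28 = 15 \<or> p mod 28 = 27"
  shows "7 dvd 122 * p ^ (2 * k + 2) + 4"
proof -
  have "p mod 7 = 1 \<or> p mod 7 = 6"
    using assms by presburger
  then have "[p ^ 2 = 1] (mod 7)"
    by (auto simp: cong_def power_mod[of p 7 2, symmetric])
  then have "[(p ^ 2) ^ (k + 1) = 1 ^ (k + 1)] (mod 7)"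
    by (rule cong_pow)
  then have "[p ^ (2 * k + 2) = 1] (mod 7)"
    by (simp only: power_mult [symmetric] power_one distrib_left mult_1_right)
  then have "[122 * p ^ (2 * k + 2) + 4 = 122 * 1 + 4] (mod 7)"
    by (intro cong_add cong_mult) auto
  then show ?thesis
    by (simp add: cong_def dvd_eq_mod_eq_0)
qed

end

theory Submission
  imports Defs "HOL-Library.Z2"
begin

text \<open>
  Modulo 2 the reciprocal of \<open>F(q) = \<Psi>(-q\<^sup>1\<^sup>1, q\<^sup>3) \<equiv> \<Sum>\<^sub>a q^(7a\<^sup>2+4a)\<close> is
  \<open>F\<^sup>7/F\<^sup>8\<close>, where \<open>F\<^sup>8 \<equiv> F(q\<^sup>8)\<close> and \<open>F\<^sup>7 \<equiv> F(q) F(q\<^sup>2) F(q\<^sup>4)\<close>. A term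
  of the triple sum for \<open>F\<^sup>7\<close> has exponent \<open>\<equiv> 2 (mod 8)\<close> only if \<open>a\<close> is even, \<open>b\<close> is
  odd and \<open>a/2 + c\<close> is odd; rotating the \<open>(a, c)\<close> plane by 45 degrees then splits off a factor
  \<open>F(q\<^sup>8)\<close>, which cancels the denominator. Hence, for \<open>N \<equiv> 2 (mod 8)\<close>, the parity
  of the coefficient at \<open>N\<close> is that of the number of solutions of
  \<open>8 (7s+3)\<^sup>2 + 2 (7b+2)\<^sup>2 = 7N - 4\<close> with \<open>b\<close> odd. For the stated \<open>N\<close>, half the right-hand
  side is divisible by \<open>p \<equiv> 3 (mod 4)\<close> to an odd power exactly, so it is not a sum of two
  squares and there are no solutions.
\<close>

section \<open>Generating functions of weighted sets\<close>

text \<open>This counts honestly only when every fibre is finite, since \<open>card\<close> of an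
  infinite set is 0; hence the hypothesis \<open>fin_fibres\<close> below. The coefficient ring is
  left open and is later one with 2 = 0.\<close>

definition gen :: "'x set \<Rightarrow> ('x \<Rightarrow> nat) \<Rightarrow> 'a::comm_ring_1 fps" where
  "gen S w = Abs_fps (\<lambda>m. of_nat (card {x \<in> S. w x = m}))"

lemma gen_nth: "fps_nth (gen S w) m = of_nat (card {x \<in> S. w x = m})"
  by (simp add: gen_def)

definition fin_fibres :: "'x set \<Rightarrow> ('x \<Rightarrow> nat) \<Rightarrow> bool" where
  "fin_fibres S w \<longleftrightarrow> (\<forall>m. finite {x \<in> S. w x = m})"

lemma fibre_Times:
  fixes w :: "'x \<Rightarrow> nat" and v :: "'y \<Rightarrow> nat"
  shows
  "{z \<in> S \<times> T. w (fst z) + v (snd z) = m} =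
     (\<Union>i\<le>m. {x \<in> S. w x = i} \<times> {y \<in> T. v y = m - i})"
  by auto

lemma fin_fibres_Times:
  assumes "fin_fibres S w" "fin_fibres T v"
  shows "fin_fibres (S \<times> T) (\<lambda>z. w (fst z) + v (snd z))"
  using assms unfolding fin_fibres_def fibre_Times by auto

lemma gen_mult:
  assumes "fin_fibres S w" "fin_fibres T v"
  shows "(gen S w * gen T v :: 'a::comm_ring_1 fps) = gen (S \<times> T) (\<lambda>z. w (fst z) + v (snd z))"
proof (rule fps_ext)
  fix m
  have fin: "finite {x \<in> S. w x = i}" "finite {y \<in> T. v y = i}" for i
    using assms by (auto simp: fin_fibres_def)
  have "card {z \<in> S \<times> T. w (fst z) + v (snd z) = m} =
          (\<Sum>i\<le>m. card {x \<in> S. w x = i} * card {y \<in> T. v y = m - i})"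
    unfolding fibre_Times
    by (subst card_UN_disjoint) (auto simp: card_cartesian_product fin)
  then show "fps_nth (gen S w * gen T v :: 'a fps) m =
               fps_nth (gen (S \<times> T) (\<lambda>z. w (fst z) + v (snd z))) m"
    by (simp add: gen_nth fps_mult_nth atLeast0AtMost)
qed

lemma gen_bij:
  assumes "bij_betw f S T" "\<And>x. x \<in> S \<Longrightarrow> v (f x) = w x"
  shows "gen S w = gen T v"
proof (rule fps_ext)
  fix m
  have "bij_betw f {x \<in> S. w x = m} {y \<in> T. v y = m}"
    using assms unfolding bij_betw_def by (auto intro: inj_on_subset)
  then show "fps_nth (gen S w) m = fps_nth (gen T v) m"
    by (simp add: gen_nth bij_betw_same_card)
qed

text \<open>Frobenius, proved by counting: swapping the two entries pairs off the solutions off the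
  diagonal, so modulo 2 only the diagonal survives. The linear order on \<open>'x\<close> separates
  a pair from its swap.\<close>

lemma gen_square_char2:
  fixes w :: "'x::linorder \<Rightarrow> nat"
  assumes "(2::'a::comm_ring_1) = 0" "fin_fibres S w"
  shows "(gen S w)\<^sup>2 = (gen S (\<lambda>x. 2 * w x) :: 'a fps)"
proof (rule fps_ext)
  fix m
  define A where "A = {z \<in> S \<times> S. w (fst z) + w (snd z) = m}"
  have "finite A"
    using fin_fibres_Times[OF assms(2,2)] by (simp add: A_def fin_fibres_def)
  have "bij_betw prod.swap {z \<in> A. fst z < snd z} {z \<in> A. snd z < fst z}"
    by (rule bij_betwI[of _ _ _ prod.swap]) (auto simp: A_def)
  then have lt: "card {z \<in> A. fst z < snd z} = card {z \<in> A. snd z < fst z}"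
    by (rule bij_betw_same_card)
  have "bij_betw (\<lambda>x. (x, x)) {x \<in> S. 2 * w x = m} {z \<in> A. fst z = snd z}"
    by (rule bij_betwI[of _ _ _ fst]) (auto simp: A_def)
  then have eq: "card {x \<in> S. 2 * w x = m} = card {z \<in> A. fst z = snd z}"
    by (rule bij_betw_same_card)
  have "card A = card ({z \<in> A. fst z = snd z} \<union> ({z \<in> A. fst z < snd z} \<union> {z \<in> A. snd z < fst z}))"
    by (rule arg_cong[of _ _ card]) auto
  also have "\<dots> = card {z \<in> A. fst z = snd z} +
                 (card {z \<in> A. fst z < snd z} + card {z \<in> A. snd z < fst z})"
    using \<open>finite A\<close> by (subst card_Un_disjoint, simp, simp, force)+ simp
  finally have "card A = card {x \<in> S. 2 * w x = m} + 2 * card {z \<in> A. snd z < fst z}"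
    by (simp add: lt eq)
  then have "(of_nat (card A) :: 'a) = of_nat (card {x \<in> S. 2 * w x = m})"
    by (simp add: assms(1))
  then show "fps_nth ((gen S w)\<^sup>2 :: 'a fps) m = fps_nth (gen S (\<lambda>x. 2 * w x)) m"
    by (simp add: power2_eq_square gen_mult assms(2) gen_nth A_def)
qed

lemma fin_fibres_scale:
  assumes "fin_fibres S w" "c > 0"
  shows "fin_fibres S (\<lambda>x. c * w x)"
  unfolding fin_fibres_def
proof
  fix m
  have "{x \<in> S. c * w x = m} \<subseteq> {x \<in> S. w x = m div c}"
    using assms(2) by auto
  then show "finite {x \<in> S. c * w x = m}"
    using assms(1) by (auto simp: fin_fibres_def intro: finite_subset)
qed

section \<open>Extracting a residue class of exponents\<close>

text \<open>The selected exponents are not rescaled, so the operator commutes with multiplication by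
  a series in q^d.\<close>

definition section_fps :: "nat \<Rightarrow> nat \<Rightarrow> 'a::comm_ring_1 fps \<Rightarrow> 'a fps" where
  "section_fps d r f = Abs_fps (\<lambda>m. if m mod d = r then fps_nth f m else 0)"

lemma section_fps_nth: "fps_nth (section_fps d r f) m = (if m mod d = r then fps_nth f m else 0)"
  by (simp add: section_fps_def)

lemma section_fps_gen: "section_fps d r (gen S w) = gen {x \<in> S. w x mod d = r} w"
proof (rule fps_ext)
  fix m
  have "{x \<in> S. w x mod d = r \<and> w x = m} = (if m mod d = r then {x \<in> S. w x = m} else {})"
    by auto
  then show "fps_nth (section_fps d r (gen S w)) m = fps_nth (gen {x \<in> S. w x mod d = r} w) m"
    by (simp add: gen_nth section_fps_nth)
qed

lemma section_fps_mult:
  assumes "\<And>i. \<not> d dvd i \<Longrightarrow> fps_nth f i = 0"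
  shows "section_fps d r (f * g) = f * section_fps d r g"
proof (rule fps_ext)
  fix m
  have mod_diff: "(m - i) mod d = m mod d" if "d dvd i" "i \<le> m" for i
    using that by (metis dvdE le_add_diff_inverse mod_mult_self4)
  have "fps_nth (f * section_fps d r g) m =
          (\<Sum>i=0..m. if m mod d = r then fps_nth f i * fps_nth g (m - i) else 0)"
    unfolding fps_mult_nth
  proof (rule sum.cong)
    fix i assume "i \<in> {0..m}"
    then show "fps_nth f i * fps_nth (section_fps d r g) (m - i) =
                 (if m mod d = r then fps_nth f i * fps_nth g (m - i) else 0)"
      by (cases "d dvd i") (auto simp: section_fps_nth mod_diff assms)
  qed simp
  then show "fps_nth (section_fps d r (f * g)) m = fps_nth (f * section_fps d r g) m"
    by (simp add: section_fps_nth fps_mult_nth)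
qed

section \<open>The theta function modulo 2\<close>

text \<open>Exponent of q in the term of index \<open>a\<close>; \<open>nat\<close> loses nothing
  because \<bar>a\<bar> \<le> a^2. Completing the square: 7 \<open>tw a\<close> + 4 =
  (7a+2)^2.\<close>

definition tw :: "int \<Rightarrow> nat" where
  "tw a = nat (7 * a\<^sup>2 + 4 * a)"

lemma abs_le_square_int: "\<bar>a\<bar> \<le> (a::int)\<^sup>2"
proof (cases "a = 0")
  case False
  then have "\<bar>a\<bar> * 1 \<le> \<bar>a\<bar> * \<bar>a\<bar>"
    by (intro mult_left_mono) auto
  then show ?thesis
    by (simp add: power2_eq_square)
qed simp

lemma int_tw: "int (tw a) = 7 * a\<^sup>2 + 4 * a"
  using abs_le_square_int[of a] by (simp add: tw_def)

lemma abs_le_tw: "\<bar>a\<bar> \<le> int (tw a)"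
  using abs_le_square_int[of a] by (simp add: int_tw)

lemma fin_fibres_tw: "fin_fibres UNIV tw"
  unfolding fin_fibres_def
proof
  fix m
  have "{x \<in> UNIV. tw x = m} \<subseteq> {- int m..int m}"
    using abs_le_tw by (auto simp: abs_le_iff) (metis abs_le_D2 minus_le_iff)
  then show "finite {x \<in> UNIV. tw x = m}"
    by (rule finite_subset) simp
qed

lemma theta_exponent_tw:
  "11 * nat (n * (n + 1) div 2) + 3 * nat (n * (n - 1) div 2) = tw n"
proof -
  obtain u where u: "n * (n + 1) = 2 * u"
    by (metis even_mult_iff even_add odd_one dvdE)
  then have v: "n * (n - 1) = 2 * (u - n)"
    by (simp add: algebra_simps)
  have "\<bar>n\<bar> \<le> n\<^sup>2" by (rule abs_le_square_int)
  then have "u \<ge> 0" "u - n \<ge> 0"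
    using u v by (auto simp: algebra_simps power2_eq_square)
  then have "int (11 * nat (n * (n + 1) div 2) + 3 * nat (n * (n - 1) div 2)) =
               14 * u - 3 * n"
    by (simp add: u v)
  also have "\<dots> = int (tw n)"
    using u by (simp add: int_tw algebra_simps power2_eq_square)
  finally show ?thesis by linarith
qed

lemma of_int_theta_term_nth:
  assumes "(2::'a::comm_ring_1) = 0"
  shows "(of_int (fps_nth (theta_term (- (fps_X ^ 11)) (fps_X ^ 3) n) m) :: 'a) =
           of_bool (tw n = m)"
proof -
  have "(-1 :: 'a) ^ k = 1" for k
    using assms by (metis add.inverse_unique one_add_one power_one)
  then show ?thesis
    by (auto simp: theta_term_fps theta_exponent_tw fps_X_power_nth)
qed

text \<open>When 2 = 0, both the signs of the terms and the minus sign between the two halves of the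
  false theta function disappear, leaving one sum over all integers.\<close>

lemma of_int_theta_series:
  assumes "(2::'a::comm_ring_1) = 0"
  shows "Abs_fps (\<lambda>m. of_int (fps_nth (theta_series 11 3) m)) = (gen UNIV tw :: 'a fps)"
proof (rule fps_ext)
  fix m
  have neg: "- x = (x::'a)" for x
    using assms by (metis add.inverse_unique mult_2 mult_zero_left)
  define P where "P = {i::nat. i \<le> m \<and> tw (int i) = m}"
  define Q where "Q = {i::nat. i \<le> m \<and> tw (- int (Suc i)) = m}"
  have PQ: "P = {..m} \<inter> {i. tw (int i) = m}" "Q = {..m} \<inter> {i. tw (- int (Suc i)) = m}"
    by (auto simp: P_def Q_def)
  have fin: "finite P" "finite Q"
    by (auto simp: P_def Q_def)
  \<comment> \<open>Truncating both index ranges at \<open>m\<close> loses no solution, because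
    \<bar>a\<bar> \<le> \<open>tw a\<close>.\<close>
  have "{a. tw a = m} = int ` P \<union> (\<lambda>i. - int (Suc i)) ` Q"
  proof (intro equalityI subsetI)
    fix a assume "a \<in> {a. tw a = m}"
    then have a: "tw a = m" "\<bar>a\<bar> \<le> int m"
      using abs_le_tw[of a] by auto
    show "a \<in> int ` P \<union> (\<lambda>i. - int (Suc i)) ` Q"
    proof (cases "a \<ge> 0")
      case True
      then have "a = int (nat a)" "nat a \<in> P"
        using a by (auto simp: P_def)
      then show ?thesis by blast
    next
      case False
      then have eq: "a = - int (Suc (nat (- a - 1)))" by simp
      moreover have "nat (- a - 1) \<in> Q"
        using a False eq unfolding Q_def by auto
      ultimately show ?thesis by blast
    qed
  qed (auto simp: P_def Q_def)
  then have "card {a. tw a = m} = card P + card Q"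
    using fin by (simp only:)
      (subst card_Un_disjoint; auto simp: card_image inj_on_def)
  moreover have "(\<Sum>i\<le>m. of_bool (tw (int i) = m)) = (of_nat (card P) :: 'a)"
    unfolding PQ by (subst sum_of_bool_eq) auto
  moreover have "(\<Sum>i\<le>m. of_bool (tw (- int (Suc i)) = m)) = (of_nat (card Q) :: 'a)"
    unfolding PQ by (subst sum_of_bool_eq) auto
  moreover have "of_int (fps_nth (theta_series 11 3) m) =
      (\<Sum>i\<le>m. of_bool (tw (int i) = m)) - (\<Sum>i\<le>m. of_bool (tw (- int (Suc i)) = m) :: 'a)"
    by (simp only: theta_series_nth[of 11 3, OF zero_less_numeral zero_less_numeral] of_int_diff of_int_sum
        of_int_theta_term_nth[OF assms])
  ultimately show "fps_nth (Abs_fps (\<lambda>m. of_int (fps_nth (theta_series 11 3) m))) m =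
                     fps_nth (gen UNIV tw :: 'a fps) m"
    by (simp only: fps_nth_Abs_fps gen_nth diff_conv_add_uminus neg of_nat_add) simp
qed

lemma Abs_fps_of_int_mult:
  "Abs_fps (\<lambda>m. of_int (fps_nth (f * g) m)) =
     Abs_fps (\<lambda>m. of_int (fps_nth f m)) * (Abs_fps (\<lambda>m. of_int (fps_nth g m)) :: 'a::comm_ring_1 fps)"
  by (rule fps_ext) (simp add: fps_mult_nth)

definition recip_fps :: "'a::comm_ring_1 fps" where
  "recip_fps = Abs_fps (\<lambda>m. of_int (theta_recip_coeff 11 3 m))"

lemma gen_tw_mult_recip:
  assumes "(2::'a::comm_ring_1) = 0"
  shows "gen UNIV tw * recip_fps = (1 :: 'a fps)"
proof -
  have "gen UNIV tw * recip_fps =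
      (Abs_fps (\<lambda>m. of_int (fps_nth (theta_series 11 3 * Abs_fps (theta_recip_coeff 11 3)) m)) :: 'a fps)"
    by (simp add: Abs_fps_of_int_mult of_int_theta_series[OF assms] recip_fps_def)
  also have "\<dots> = 1"
    by (rule fps_ext) (simp add: theta_series_mult_recip)
  finally show ?thesis .
qed

section \<open>The exponents congruent to 2 modulo 8\<close>

definition triple_weight :: "int \<times> int \<times> int \<Rightarrow> nat" where
  "triple_weight = (\<lambda>(a, b, c). tw a + (2 * tw b + 4 * tw c))"

text \<open>Chosen so that 7 \<open>pair_weight (s, b)\<close> - 4 = 8(7s+3)^2 + 2(7b+2)^2. The
  quadratic in \<open>s\<close> is positive at every integer.\<close>

definition pair_weight :: "int \<times> int \<Rightarrow> nat" where
  "pair_weight = (\<lambda>(s, b). nat (56 * s\<^sup>2 + 48 * s + 12) + 2 * tw b)"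

lemma int_pair_weight: "int (pair_weight (s, b)) = 56 * s\<^sup>2 + 48 * s + 12 + 2 * (7 * b\<^sup>2 + 4 * b)"
  using abs_le_square_int[of s] by (simp add: pair_weight_def int_tw)

lemma fin_fibres_pair_weight: "fin_fibres {(s, b). odd b} pair_weight"
  unfolding fin_fibres_def
proof
  fix m
  have "{x \<in> {(s, b). odd b}. pair_weight x = m} \<subseteq> {- int m..int m} \<times> {- int m..int m}"
  proof
    fix x assume "x \<in> {x \<in> {(s, b). odd b}. pair_weight x = m}"
    then obtain s b where x: "x = (s, b)" "pair_weight (s, b) = m"
      by (cases x) auto
    then have "int m = 56 * s\<^sup>2 + 48 * s + 12 + 14 * b\<^sup>2 + 8 * b"
      using int_pair_weight[of s b] by simp
    moreover have "s \<le> s\<^sup>2" "- s \<le> s\<^sup>2" "b \<le> b\<^sup>2" "- b \<le> b\<^sup>2"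
      using abs_le_square_int[of s] abs_le_square_int[of b] by auto
    ultimately have "s \<le> int m" "- s \<le> int m" "b \<le> int m" "- b \<le> int m"
      by linarith+
    then show "x \<in> {- int m..int m} \<times> {- int m..int m}"
      by (simp add: x(1))
  qed
  then show "finite {x \<in> {(s, b). odd b}. pair_weight x = m}"
    by (rule finite_subset) simp
qed

text \<open>Each squaring doubles the weights; the seventh power is assembled from 7 = 1 + 2 +
  4.\<close>

lemma gen_tw_powers:
  assumes "(2::'a::comm_ring_1) = 0"
  shows "gen UNIV tw ^ 7 = (gen UNIV triple_weight :: 'a fps)"
    and "gen UNIV tw ^ 8 = (gen UNIV (\<lambda>a. 8 * tw a) :: 'a fps)"
proof -
  have fin: "fin_fibres UNIV (\<lambda>a. c * tw a)" if "c > 0" for c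
    using fin_fibres_scale[OF fin_fibres_tw that] .
  have p2: "(gen UNIV tw)\<^sup>2 = (gen UNIV (\<lambda>a. 2 * tw a) :: 'a fps)"
    by (rule gen_square_char2[OF assms fin_fibres_tw])
  have "(gen UNIV tw :: 'a fps) ^ 4 = ((gen UNIV tw)\<^sup>2)\<^sup>2"
    by (simp flip: power_mult)
  also have "\<dots> = gen UNIV (\<lambda>a. 4 * tw a)"
    unfolding p2 using gen_square_char2[OF assms fin[of 2]] by simp
  finally have p4: "(gen UNIV tw :: 'a fps) ^ 4 = gen UNIV (\<lambda>a. 4 * tw a)" .
  have "(gen UNIV tw :: 'a fps) ^ 8 = ((gen UNIV tw) ^ 4)\<^sup>2"
    by (simp flip: power_mult)
  also have "\<dots> = gen UNIV (\<lambda>a. 8 * tw a)"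
    unfolding p4 using gen_square_char2[OF assms fin[of 4]] by simp
  finally show "gen UNIV tw ^ 8 = (gen UNIV (\<lambda>a. 8 * tw a) :: 'a fps)" .
  have "(gen UNIV tw :: 'a fps) ^ 7 = gen UNIV tw * ((gen UNIV tw)\<^sup>2 * gen UNIV tw ^ 4)"
    by (simp add: eval_nat_numeral mult_ac)
  also have "\<dots> = gen UNIV triple_weight"
    unfolding p2 p4
    by (simp add: gen_mult fin fin_fibres_tw fin_fibres_Times[OF fin fin, simplified]
        triple_weight_def case_prod_unfold)
  finally show "gen UNIV tw ^ 7 = (gen UNIV triple_weight :: 'a fps)" .
qed

text \<open>An odd \<open>a\<close> makes the weight odd. For a = 2a' the weight is 4(a'+c) + 6b^2
  modulo 8: this is 0 or 4 for even \<open>b\<close>, and for odd \<open>b\<close> it is 2 exactly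
  when a'+c is odd.\<close>

lemma triple_weight_mod_8:
  "triple_weight (a, b, c) mod 8 = 2 \<longleftrightarrow> even a \<and> odd b \<and> odd (a div 2 + c)"
proof -
  have odd_mod_8: "x mod 8 \<noteq> 2" if "odd x" for x :: int
    using that by presburger
  have "triple_weight (a, b, c) mod 8 = 2 \<longleftrightarrow> int (triple_weight (a, b, c)) mod 8 = 2"
  proof -
    have "int (triple_weight (a, b, c)) mod 8 = int (triple_weight (a, b, c) mod 8)"
      by (simp add: zmod_int)
    then show ?thesis by linarith
  qed
  also have "int (triple_weight (a, b, c)) =
      7 * a\<^sup>2 + 4 * a + 2 * (7 * b\<^sup>2 + 4 * b) + 4 * (7 * c\<^sup>2 + 4 * c)"
    by (simp add: triple_weight_def int_tw)
  also have "\<dots> mod 8 = 2 \<longleftrightarrow> even a \<and> odd b \<and> odd (a div 2 + c)"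
  proof (cases "even a")
    case True
    then obtain a' where a: "a = 2 * a'" by blast
    \<comment> \<open>Only the parities of a', b, c matter: all terms involving the quotients by 2
      are collected in 8 \<open>K\<close>, leaving eight cases.\<close>
    define x i where "x = a' div 2" "i = a' mod 2"
    define y j where "y = b div 2" "j = b mod 2"
    define z k where "z = c div 2" "k = c mod 2"
    have abc: "a' = 2 * x + i" "b = 2 * y + j" "c = 2 * z + k"
      by (simp_all add: x_i_def y_j_def z_k_def)
    have ijk: "i = 0 \<or> i = 1" "j = 0 \<or> j = 1" "k = 0 \<or> k = 1"
      by (auto simp: x_i_def y_j_def z_k_def)
    define K where "K = 14 * x\<^sup>2 + 14 * x * i + 2 * x + 7 * y\<^sup>2 + 7 * y * j + 2 * y
                         + 14 * z\<^sup>2 + 14 * z * k + 4 * z"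
    have "7 * a\<^sup>2 + 4 * a + 2 * (7 * b\<^sup>2 + 4 * b) + 4 * (7 * c\<^sup>2 + 4 * c) =
            28 * i\<^sup>2 + 8 * i + 14 * j\<^sup>2 + 8 * j + 28 * k\<^sup>2 + 16 * k + 8 * K"
      unfolding a abc K_def by (simp add: power2_eq_square algebra_simps)
    then have "(7 * a\<^sup>2 + 4 * a + 2 * (7 * b\<^sup>2 + 4 * b) + 4 * (7 * c\<^sup>2 + 4 * c)) mod 8 =
                 (28 * i\<^sup>2 + 8 * i + 14 * j\<^sup>2 + 8 * j + 28 * k\<^sup>2 + 16 * k) mod 8"
      by simp
    moreover have "even a \<and> odd b \<and> odd (a div 2 + c) \<longleftrightarrow> odd j \<and> odd (i + k)"
      unfolding a abc by auto
    ultimately show ?thesis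
      using ijk by (elim disjE) simp_all
  next
    case False
    then have "odd (7 * a\<^sup>2 + 4 * a + 2 * (7 * b\<^sup>2 + 4 * b) + 4 * (7 * c\<^sup>2 + 4 * c))"
      by simp
    then show ?thesis
      using False odd_mod_8 by auto
  qed
  finally show ?thesis .
qed

text \<open>
  The substitution is \<open>7a/2 + 1 = U + V\<close>, \<open>7c + 2 = U - V\<close> with \<open>U = -(7u + 2)\<close> and
  \<open>V = 7s + 3\<close>.
\<close>

lemma section_gen_triple_weight:
  "section_fps 8 2 (gen UNIV triple_weight) =
     (gen UNIV (\<lambda>a. 8 * tw a) * gen {(s, b). odd b} pair_weight :: 'a::comm_ring_1 fps)"
proof -
  define f :: "int \<times> int \<times> int \<Rightarrow> int \<times> int \<times> int" where
    "f = (\<lambda>(u, s, b). (2 * (s - u), b, - u - s - 1))"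
  \<comment> \<open>Both halvings are exact on the target set, where \<open>a div 2 + c\<close> is
    odd.\<close>
  define g :: "int \<times> int \<times> int \<Rightarrow> int \<times> int \<times> int" where
    "g = (\<lambda>(a, b, c). ((- c - 1 - a div 2) div 2, (a div 2 - c - 1) div 2, b))"
  have bij: "bij_betw f (UNIV \<times> {(s, b). odd b}) {x. triple_weight x mod 8 = 2}"
  proof (rule bij_betwI[of _ _ _ g])
    show "f \<in> UNIV \<times> {(s, b). odd b} \<rightarrow> {x. triple_weight x mod 8 = 2}"
      by (auto simp: f_def triple_weight_mod_8)
    show "g \<in> {x. triple_weight x mod 8 = 2} \<rightarrow> UNIV \<times> {(s, b). odd b}"
      by (auto simp: g_def triple_weight_mod_8)
    show "g (f x) = x" for x
      by (cases x) (simp add: f_def g_def algebra_simps)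
    show "f (g x) = x" if x: "x \<in> {x. triple_weight x mod 8 = 2}" for x
    proof -
      obtain a b c where abc: "x = (a, b, c)" by (cases x)
      with x obtain a' where a': "a = 2 * a'" "odd b" "odd (a' + c)"
        by (auto simp: triple_weight_mod_8)
      then show ?thesis
        unfolding abc f_def g_def by simp presburger
    qed
  qed
  \<comment> \<open>After completing squares this is 4(U+V)^2 + 4(U-V)^2 = 8U^2 + 8V^2: U^2 accounts
    for \<open>8 * tw u\<close> and V^2 for the part of \<open>pair_weight\<close> in
    \<open>s\<close>.\<close>
  have weight: "triple_weight (f x) = 8 * tw (fst x) + pair_weight (snd x)" for x
  proof -
    obtain u s b where x: "x = (u, s, b)" by (cases x)
    have "int (triple_weight (f x)) = int (8 * tw (fst x) + pair_weight (snd x))"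
      unfolding x f_def
      by (simp add: int_pair_weight int_tw triple_weight_def power2_eq_square algebra_simps)
    then show ?thesis by linarith
  qed
  have "gen UNIV (\<lambda>a. 8 * tw a) * gen {(s, b). odd b} pair_weight =
          (gen (UNIV \<times> {(s, b). odd b}) (\<lambda>x. 8 * tw (fst x) + pair_weight (snd x)) :: 'a fps)"
    by (rule gen_mult) (auto intro: fin_fibres_scale fin_fibres_tw fin_fibres_pair_weight)
  also have "\<dots> = gen {x \<in> UNIV. triple_weight x mod 8 = 2} triple_weight"
    using bij by (intro gen_bij) (auto simp: weight)
  finally show ?thesis
    by (simp only: section_fps_gen)
qed

text \<open>From F^8 / F = F^7: the series F(q^8) has only exponents divisible by 8, so it passes
  through the section and meets the factor split off on the other side. It is nonzero because F is a
  unit, and an integral domain allows the cancellation.\<close>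

lemma section_recip_fps:
  assumes "(2::'a::idom) = 0"
  shows "section_fps 8 2 recip_fps = (gen {(s, b). odd b} pair_weight :: 'a fps)"
proof -
  let ?F = "gen UNIV tw :: 'a fps"
  have "?F ^ 8 * recip_fps = ?F ^ 7 * (?F * recip_fps)"
    by (simp add: eval_nat_numeral mult_ac)
  then have "?F ^ 8 * recip_fps = ?F ^ 7"
    by (simp add: gen_tw_mult_recip[OF assms])
  then have eq: "gen UNIV (\<lambda>a. 8 * tw a) * recip_fps = (gen UNIV triple_weight :: 'a fps)"
    by (simp add: gen_tw_powers[OF assms])
  have supp: "fps_nth (gen UNIV (\<lambda>a. 8 * tw a) :: 'a fps) i = 0" if "\<not> 8 dvd i" for i
  proof -
    have "{x \<in> UNIV. 8 * tw x = i} = {}"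
      using that by auto
    then show ?thesis by (simp add: gen_nth)
  qed
  have "gen UNIV (\<lambda>a. 8 * tw a) * section_fps 8 2 recip_fps =
          (gen UNIV (\<lambda>a. 8 * tw a) * gen {(s, b). odd b} pair_weight :: 'a fps)"
    unfolding section_gen_triple_weight [symmetric] eq [symmetric]
    by (rule section_fps_mult [symmetric]) (rule supp)
  moreover have "(gen UNIV (\<lambda>a. 8 * tw a) :: 'a fps) \<noteq> 0"
    using gen_tw_mult_recip[OF assms] gen_tw_powers(2)[OF assms]
    by (metis mult_zero_left power_not_zero zero_neq_one)
  ultimately show ?thesis
    by simp
qed

lemma of_int_bit_eq_0_iff: "(of_int x :: bit) = 0 \<longleftrightarrow> even x"
proof (cases "even x")
  case True
  then show ?thesis by (auto elim!: evenE)
next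
  case False
  then show ?thesis by (auto elim!: oddE simp del: add_bit_eq_xor)
qed

text \<open>The ring is now specialised to the two-element field \<open>bit\<close>, where an empty
  fibre gives coefficient 0.\<close>

lemma even_recip_coeff:
  assumes "N mod 8 = 2" "\<And>s b. pair_weight (s, b) \<noteq> N"
  shows "even (theta_recip_coeff 11 3 N)"
proof -
  have "(of_int (theta_recip_coeff 11 3 N) :: bit) = fps_nth (section_fps 8 2 recip_fps) N"
    by (simp add: section_fps_nth assms(1) recip_fps_def)
  also have "\<dots> = of_nat (card {x \<in> {(s, b). odd b}. pair_weight x = N})"
    by (simp only: section_recip_fps[OF bit_2_eq_0] gen_nth)
  also have "{x \<in> {(s, b). odd b}. pair_weight x = N} = {}"
    using assms(2) by auto
  finally show ?thesis
    by (simp add: of_int_bit_eq_0_iff)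
qed

section \<open>Sums of two squares\<close>

text \<open>Otherwise x^2 = -y^2 modulo p with both prime to p. Raising this to the power (p-1)/2,
  which is odd, keeps the sign, and Fermat turns it into 1 = -1 modulo p.\<close>

lemma prime_3_mod_4_dvd_sum_squares:
  fixes p x y :: nat
  assumes "prime p" "p mod 4 = 3" "p dvd x\<^sup>2 + y\<^sup>2"
  shows "p dvd x"
proof (rule ccontr)
  assume x: "\<not> p dvd x"
  have y: "\<not> p dvd y"
  proof
    assume "p dvd y"
    then have "p dvd x\<^sup>2"
      using assms(3) by (simp add: power2_eq_square dvd_add_left_iff)
    then show False
      using x assms(1) prime_dvd_power by blast
  qed
  define h where "h = (p - 1) div 2"
  have h: "odd h" "p - 1 = 2 * h"
    using assms(2) unfolding h_def by presburger+
  have "[int x ^ 2 = - (int y ^ 2)] (mod int p)"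
    using assms(3) by (simp add: cong_iff_dvd_diff flip: of_nat_power of_nat_add)
  then have "[(int x ^ 2) ^ h = (- (int y ^ 2)) ^ h] (mod int p)"
    by (rule cong_pow)
  then have "[int x ^ (p - 1) = - (int y ^ (p - 1))] (mod int p)"
    using h by (simp add: power_mult)
  then have "p dvd x ^ (p - 1) + y ^ (p - 1)"
    by (simp add: cong_iff_dvd_diff flip: of_nat_power of_nat_add)
  moreover have "[x ^ (p - 1) + y ^ (p - 1) = 1 + 1] (mod p)"
    using fermat_theorem assms(1) x y by (intro cong_add) auto
  ultimately have "p dvd 2"
    by (metis cong_dvd_iff one_add_one)
  then have "p \<le> 2"
    by (rule dvd_imp_le) simp
  then show False
    using assms(1,2) prime_ge_2_nat[of p] by simp
qed

text \<open>Descent: p divides both x and y, so p^2 cancels and the exponent drops by 2. At exponent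
  1 the same division forces p to divide \<open>m\<close>.\<close>

lemma sum_squares_neq_odd_prime_power:
  fixes p x y k m :: nat
  assumes "prime p" "p mod 4 = 3" "\<not> p dvd m"
  shows "x\<^sup>2 + y\<^sup>2 \<noteq> p ^ (2 * k + 1) * m"
proof (induction k arbitrary: x y)
  have step: "\<exists>x' y'. x = p * x' \<and> y = p * y'"
    if "x\<^sup>2 + y\<^sup>2 = p * j" for x y j
    using prime_3_mod_4_dvd_sum_squares[OF assms(1,2), of x y]
      prime_3_mod_4_dvd_sum_squares[OF assms(1,2), of y x] that
    by (simp add: add.commute dvd_def)
  have p: "p > 0"
    using assms(1) by (rule prime_gt_0_nat)
  {
    case 0
    show ?case
    proof
      assume eq: "x\<^sup>2 + y\<^sup>2 = p ^ (2 * 0 + 1) * m"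
      then obtain x' y' where "x = p * x'" "y = p * y'"
        using step[of x y m] by auto
      with eq have "p * (p * (x'\<^sup>2 + y'\<^sup>2)) = p * m"
        by (simp add: power2_eq_square algebra_simps)
      then show False
        using p assms(3) by auto
    qed
  next
    case (Suc k)
    show ?case
    proof
      assume eq: "x\<^sup>2 + y\<^sup>2 = p ^ (2 * Suc k + 1) * m"
      then have "x\<^sup>2 + y\<^sup>2 = p * (p ^ (2 * k + 2) * m)"
        by simp
      then obtain x' y' where "x = p * x'" "y = p * y'"
        using step by blast
      with eq have "p\<^sup>2 * (x'\<^sup>2 + y'\<^sup>2) = p\<^sup>2 * (p ^ (2 * k + 1) * m)"
        by (simp add: power2_eq_square algebra_simps)
      then have "x'\<^sup>2 + y'\<^sup>2 = p ^ (2 * k + 1) * m"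
        using p by simp
      then show False
        using Suc.IH by blast
    qed
  }
qed

section \<open>The coefficients on the progression\<close>

theorem theorem5p3:
  fixes p n k :: nat
  assumes "prime p"
    and "p mod 28 = 15 \<or> p mod 28 = 27"
    and "\<not> p dvd n"
  shows "[theta_recip_coeff 11 3
            (8 * p ^ (2 * k + 1) * n + (122 * p ^ (2 * k + 2) + 4) div 7) = 0] (mod 2)"
proof -
  define N where "N = 8 * p ^ (2 * k + 1) * n + (122 * p ^ (2 * k + 2) + 4) div 7"
  have N7: "7 * N = 56 * p ^ (2 * k + 1) * n + 122 * p ^ (2 * k + 2) + 4"
    using seven_dvd_progression_offset[OF assms(2), of k] by (simp add: N_def algebra_simps)
  have "p mod 4 = p mod 28 mod 4"
    by (simp add: mod_mod_cancel)
  then have "p mod 4 = 3"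
    using assms(2) by auto
  have "p ^ (2 * k + 2) mod 8 = 1"
  proof -
    have "p mod 8 = 3 \<or> p mod 8 = 7"
      using \<open>p mod 4 = 3\<close> by presburger
    then have "[p\<^sup>2 = 1] (mod 8)"
      by (auto simp: cong_def power_mod[of p 8 2, symmetric])
    then have "[(p\<^sup>2) ^ (k + 1) = 1 ^ (k + 1)] (mod 8)"
      by (rule cong_pow)
    then show ?thesis
      by (simp only: cong_def power_mult [symmetric] power_one distrib_left mult_1_right) simp
  qed
  then have "p ^ (2 * k + 2) = 8 * (p ^ (2 * k + 2) div 8) + 1"
    by (metis mult_div_mod_eq)
  then obtain t where t: "p ^ (2 * k + 2) = 8 * t + 1" ..
  \<comment> \<open>The constant is 126 = 122 + 4, congruent to 14 = 7 * 2 modulo 8; the factor 7 is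
    then cancelled.\<close>
  have "7 * N = 8 * (7 * p ^ (2 * k + 1) * n + 122 * t) + 126"
    unfolding N7 t by simp
  then obtain K where "7 * N = 8 * K + 126" ..
  then have "[7 * N = 7 * 2] (mod 8)"
    by (simp add: cong_def)
  moreover have "coprime 7 (8 :: nat)"
    using coprime_Suc_right_nat[of 7] by simp
  ultimately have "[N = 2] (mod 8)"
    by (simp only: cong_mult_lcancel_nat)
  then have N8: "N mod 8 = 2"
    by (simp add: cong_def)
  \<comment> \<open>The cofactor of p^(2k+1) in (7N - 4)/2 is 61p + 28n; it must be prime to p for
    the power of p to be exactly odd.\<close>
  have "\<not> p dvd 28"
  proof
    assume "p dvd 28"
    then have "p dvd 2 * (2 * 7)" by simp
    then have "p dvd 2 \<or> p dvd 7"
      using assms(1) by (meson prime_dvd_mult_iff)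
    then have "p \<le> 7"
      by (auto dest: dvd_imp_le)
    then show False
      using assms(2) by auto
  qed
  then have ndvd: "\<not> p dvd 61 * p + 28 * n"
    using assms(1,3) by (simp add: dvd_add_right_iff prime_dvd_mult_iff)
  have "pair_weight (s, b) \<noteq> N" for s b
  proof
    assume "pair_weight (s, b) = N"
    then have "7 * (56 * s\<^sup>2 + 48 * s + 12 + 2 * (7 * b\<^sup>2 + 4 * b)) = int (7 * N)"
      using int_pair_weight[of s b] by simp
    \<comment> \<open>The coefficient 8 is written as 2 * 2^2, so that half of 7N - 4 becomes a sum
      of two squares.\<close>
    then have "2 * ((2 * (7 * s + 3))\<^sup>2 + (7 * b + 2)\<^sup>2) = int (7 * N) - 4"
      by (simp add: power2_eq_square algebra_simps)
    also have "\<dots> = 2 * int (p ^ (2 * k + 1) * (61 * p + 28 * n))"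
      unfolding N7 by (simp add: algebra_simps)
    finally have "(2 * (7 * s + 3))\<^sup>2 + (7 * b + 2)\<^sup>2 = int (p ^ (2 * k + 1) * (61 * p + 28 * n))"
      by (subst (asm) mult_left_cancel) simp_all
    then have "int ((nat \<bar>2 * (7 * s + 3)\<bar>)\<^sup>2 + (nat \<bar>7 * b + 2\<bar>)\<^sup>2) =
                 int (p ^ (2 * k + 1) * (61 * p + 28 * n))"
      by simp
    then show False
      using sum_squares_neq_odd_prime_power[OF assms(1) \<open>p mod 4 = 3\<close> ndvd]
      by (simp only: of_nat_eq_iff)
  qed
  then have "even (theta_recip_coeff 11 3 N)"
    using N8 by (intro even_recip_coeff)
  then show ?thesis
    unfolding N_def by (simp add: cong_0_iff)
qed

end
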